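(* Let $X$ be a non-empty Lindelöf locally compact Hausdorff space, let $\mathcal{I}$ be a Riesz ideal of $C(X)$, let $V$ be an ordered vector space and $\Phi,\Psi\colon\mathcal{I}\to V$ two positive linear maps that are strictly $\mathcal{I}$-continuous. If $\Phi$ and $\Psi$ coincide on a strictly point-separating and nowhere-vanishing Riesz subspace $\mathcal{R}$ of $\mathcal{I}$, or on a strictly point-separating and nowhere-vanishing linear subspace $\mathcal{B}$ of $\mathcal{I}\cap C_b(X)$ that is also a subalgebra of $C_b(X)$, then $\Phi=\Psi$.
   Context: $C(X)$ is the algebra of real-valued continuous functions on $X$ with pointwise operations and pointwise order; $|f|$ is the pointwise absolute value. $C_b(X)\subseteq C(X)$ is the subalgebra of uniformly bounded functions. A subalgebra is a linear subspace closed under multiplication (not required to contain the unit). A Riesz ideal of $C(X)$ is a linear subspace $\mathcal{I}\subseteq C(X)$ such that $f\in C(X)$, $g\in\mathcal{I}$ and $|f|\le|g|$ imply $f\in\mathcal{I}$; $\mathcal{I}^+$ denotes the set of functions in $\mathcal{I}$ that are $\ge0$. A Riesz subspace of $\mathcal{I}$ is a linear subspace $\mathcal{R}\subseteq\mathcal{I}$ with $|r|\in\mathcal{R}$ for all $r\in\mathcal{R}$. A subset $S\subseteq C(X)$ is strictly point-separating if for all $x,y\in X$ with $x\ne y$ there is $s\in S$ with $s(x)\neq 0$ and $s(y)=0$; it is nowhere-vanishing if for every $x\in X$ there is $s\in S$ with $s(x)\ne 0$. An ordered vector space is a real vector space $V$ with a partial order $\le$ such that $u\le v$ implies $\lambda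 u\le\lambda v$ and $u+w\le v+w$ for all $\lambda\in[0,\infty)$, $w\in V$. A linear map $\Phi\colon\mathcal{I}\to V$ is positive if $\Phi(f)\ge0$ for all $f\in\mathcal{I}^+$. A positive linear map $\Phi\colon\mathcal{I}\to V$ is strictly $\mathcal{I}$-continuous if for every decreasing sequence $(f_k)_{k\in\mathbb{N}}$ in $\mathcal{I}$ with pointwise infimum $0$ (i.e. $\inf_k f_k(x)=0$ for all $x\in X$), the decreasing sequence $(\Phi(f_k))_{k\in\mathbb{N}}$ in $V$ has infimum $0$. *)

theory Defs
  imports
    "HOL-Analysis.Analysis"
    "HOL-Library.Function_Algebras"
    "HOL-Library.Lub_Glb"
begin

text \<open>Pointwise scalar multiplication. With the ring operations of
  \<^theory>\<open>HOL-Library.Function_Algebras\<close> and the pointwise order on functions from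
  \<^theory>\<open>Main\<close>, this gives the structure that \<open>C(X)\<close> inherits from the space of all functions
  \<open>X \<rightarrow> \<real>\<close>; in particular, linear subspaces are those of the library constant \<^const>\<open>subspace\<close>.\<close>

instantiation "fun" :: (type, real_vector) real_vector
begin

definition scaleR_fun :: "real \<Rightarrow> ('a \<Rightarrow> 'b) \<Rightarrow> 'a \<Rightarrow> 'b" where
  "scaleR_fun c f = (\<lambda>x. c *\<^sub>R f x)"

instance
  by standard (simp_all add: scaleR_fun_def fun_eq_iff scaleR_add_right scaleR_add_left)

end

lemma scaleR_fun_apply [simp]: "(c *\<^sub>R f) x = c *\<^sub>R f x"
  by (simp add: scaleR_fun_def)

definition Cfun :: "('a::topological_space \<Rightarrow> real) set" where
  "Cfun = {f. continuous_on UNIV f}"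

text \<open>A subalgebra need not contain the unit.\<close>

definition subalgebra_of :: "('a \<Rightarrow> real) set \<Rightarrow> ('a \<Rightarrow> real) set \<Rightarrow> bool" where
  "subalgebra_of A B \<longleftrightarrow> B \<subseteq> A \<and> subspace B \<and> (\<forall>f\<in>B. \<forall>g\<in>B. f * g \<in> B)"

definition riesz_ideal :: "('a::topological_space \<Rightarrow> real) set \<Rightarrow> bool" where
  "riesz_ideal I \<longleftrightarrow> I \<subseteq> Cfun \<and> subspace I \<and>
     (\<forall>f\<in>Cfun. \<forall>g\<in>I. (\<forall>x. \<bar>f x\<bar> \<le> \<bar>g x\<bar>) \<longrightarrow> f \<in> I)"

definition riesz_subspace_of :: "('a \<Rightarrow> real) set \<Rightarrow> ('a \<Rightarrow> real) set \<Rightarrow> bool" where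
  "riesz_subspace_of I R \<longleftrightarrow> R \<subseteq> I \<and> subspace R \<and> (\<forall>r\<in>R. (\<lambda>x. \<bar>r x\<bar>) \<in> R)"

definition strictly_point_separating :: "('a \<Rightarrow> real) set \<Rightarrow> bool" where
  "strictly_point_separating S \<longleftrightarrow> (\<forall>x y. x \<noteq> y \<longrightarrow> (\<exists>s\<in>S. s x \<noteq> 0 \<and> s y = 0))"

definition nowhere_vanishing :: "('a \<Rightarrow> real) set \<Rightarrow> bool" where
  "nowhere_vanishing S \<longleftrightarrow> (\<forall>x. \<exists>s\<in>S. s x \<noteq> 0)"

text \<open>A map \<open>\<I> \<rightarrow> V\<close> is represented by a total function of which only the values on \<open>\<I>\<close> matter.\<close>

definition linear_map_on :: "('a \<Rightarrow> real) set \<Rightarrow> (('a \<Rightarrow> real) \<Rightarrow> 'v::real_vector) \<Rightarrow> bool" where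
  "linear_map_on I \<Phi> \<longleftrightarrow>
     (\<forall>f\<in>I. \<forall>g\<in>I. \<Phi> (f + g) = \<Phi> f + \<Phi> g) \<and> (\<forall>c. \<forall>f\<in>I. \<Phi> (c *\<^sub>R f) = c *\<^sub>R \<Phi> f)"

definition positive_linear_map_on ::
    "('a \<Rightarrow> real) set \<Rightarrow> (('a \<Rightarrow> real) \<Rightarrow> 'v::ordered_real_vector) \<Rightarrow> bool" where
  "positive_linear_map_on I \<Phi> \<longleftrightarrow> linear_map_on I \<Phi> \<and> (\<forall>f\<in>I. 0 \<le> f \<longrightarrow> 0 \<le> \<Phi> f)"

text \<open>Infima are expressed with \<^const>\<open>isGlb\<close>: the operator \<^const>\<open>Inf\<close> is unavailable on a general
  ordered vector space, and on \<open>\<real>\<close> it takes an unspecified value on sets unbounded below.\<close>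

definition strictly_continuous_on ::
    "('a \<Rightarrow> real) set \<Rightarrow> (('a \<Rightarrow> real) \<Rightarrow> 'v::ordered_real_vector) \<Rightarrow> bool" where
  "strictly_continuous_on I \<Phi> \<longleftrightarrow>
     (\<forall>f :: nat \<Rightarrow> 'a \<Rightarrow> real.
        range f \<subseteq> I \<and> decseq f \<and> (\<forall>x. isGlb UNIV (range (\<lambda>k. f k x)) 0) \<longrightarrow>
        isGlb UNIV (range (\<lambda>k. \<Phi> (f k))) 0)"

end

theory Submission
  imports Defs
begin

text \<open>Two strictly continuous maps that agree along a pointwise decreasing sequence agree at its
  limit (\<open>agree_at_decseq_limit\<close>), because the infimum that characterises the limit value is
  unique. The task is therefore to reach each function of \<open>\<I>\<close> from the given subspace.

  A Lindelof locally compact Hausdorff space is \<open>\<sigma>\<close>-compact and carries compactly supported cutoffs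
  \<open>\<phi>\<^sub>n\<close> that increase to \<open>1\<close>. Since \<open>f \<cdot> \<phi>\<^sub>n\<close> increases to \<open>f\<close> for \<open>f \<ge> 0\<close>, it suffices to treat
  functions \<open>f \<ge> 0\<close> of compact support.

  Let \<open>\<R>\<close> be a Riesz subspace. Strict point separation together with nowhere vanishing lets \<open>\<R>\<close>
  interpolate arbitrary values at any two points, so the lattice form of the Stone--Weierstrass
  theorem makes \<open>\<R>\<close> uniformly dense on every compact set. On a compact set that contains the support
  of \<open>f\<close>, choose \<open>r \<in> \<R>\<close> slightly above \<open>f\<close>; the positive part of \<open>r\<close> then dominates \<open>f\<close>
  everywhere, since \<open>f = 0\<close> off its support. Running minima of such functions along an exhaustion
  of the space by compact sets decrease to \<open>f\<close>
  (\<open>riesz_subspace_decseq_to_compact_support\<close>).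

  For a subalgebra \<open>\<B>\<close> one would like to replace \<open>\<B>\<close> by its uniform closure, which is a Riesz
  subspace of \<open>C\<^sub>b(X)\<close>, but the closure need not lie in \<open>\<I>\<close>. This is cured by localisation: for
  \<open>c \<in> \<B>\<close> with \<open>c \<ge> 0\<close>, the map \<open>h \<mapsto> \<Phi> (c \<cdot> h)\<close> is defined on the whole Riesz ideal \<open>C\<^sub>b(X)\<close>, is
  strictly continuous there, and changes by at most \<open>e \<cdot> \<Phi> c\<close> when \<open>h\<close> changes uniformly by at
  most \<open>e\<close>. It agrees with the map obtained from \<open>\<Psi>\<close> on \<open>\<B>\<close>, because \<open>c \<cdot> b \<in> \<B>\<close>; then on the
  uniform closure of \<open>\<B>\<close>, because multiples \<open>e \<cdot> \<Phi> c\<close> become negligible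
  (\<open>archimedean_on_range\<close>); and then, by the case of a Riesz subspace, on \<open>C\<^sub>b(X)\<close>.
  A function \<open>f\<close> with compact support \<open>K\<close> has the form \<open>c \<cdot> h\<close> with \<open>h \<in> C\<^sub>b(X)\<close> as soon as \<open>c \<ge> 1\<close> on \<open>K\<close>, and a finite sum of squares from \<open>\<B>\<close> provides such
  a \<open>c\<close>.\<close>

section \<open>Pointwise operations on function spaces\<close>

lemma subspace_pointwise:
  fixes S :: "('a \<Rightarrow> real) set"
  assumes "subspace S"
  shows "(\<lambda>x. 0) \<in> S"
    and "f \<in> S \<Longrightarrow> g \<in> S \<Longrightarrow> (\<lambda>x. f x + g x) \<in> S"
    and "f \<in> S \<Longrightarrow> g \<in> S \<Longrightarrow> (\<lambda>x. f x - g x) \<in> S"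
    and "f \<in> S \<Longrightarrow> (\<lambda>x. c * f x) \<in> S"
    and "f \<in> S \<Longrightarrow> (\<lambda>x. - f x) \<in> S"
  using subspace_0[OF assms] subspace_add[OF assms, of f g] subspace_diff[OF assms, of f g]
    subspace_scale[OF assms, of f c] subspace_neg[OF assms, of f]
  by (simp_all add: zero_fun_def plus_fun_def fun_diff_def fun_Compl_def scaleR_fun_def)

lemma linear_map_on_pointwise:
  fixes \<Phi> :: "('a \<Rightarrow> real) \<Rightarrow> 'v::real_vector"
  assumes "linear_map_on I \<Phi>" and "subspace I"
  shows "f \<in> I \<Longrightarrow> g \<in> I \<Longrightarrow> \<Phi> (\<lambda>x. f x + g x) = \<Phi> f + \<Phi> g"
    and "f \<in> I \<Longrightarrow> g \<in> I \<Longrightarrow> \<Phi> (\<lambda>x. f x - g x) = \<Phi> f - \<Phi> g"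
    and "f \<in> I \<Longrightarrow> \<Phi> (\<lambda>x. c * f x) = c *\<^sub>R \<Phi> f"
    and "f \<in> I \<Longrightarrow> \<Phi> (\<lambda>x. - f x) = - \<Phi> f"
proof -
  show add: "\<Phi> (\<lambda>x. f x + g x) = \<Phi> f + \<Phi> g" if "f \<in> I" "g \<in> I" for f g
    using assms(1) that by (simp add: linear_map_on_def plus_fun_def)
  show scale: "\<Phi> (\<lambda>x. c * f x) = c *\<^sub>R \<Phi> f" if "f \<in> I" for f c
    using assms(1) that by (simp add: linear_map_on_def scaleR_fun_def)
  show neg: "\<Phi> (\<lambda>x. - f x) = - \<Phi> f" if "f \<in> I" for f
    using scale[OF that, of "-1"] by simp
  show "\<Phi> (\<lambda>x. f x - g x) = \<Phi> f - \<Phi> g" if "f \<in> I" "g \<in> I" for f g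
    using add[OF that(1) subspace_pointwise(5)[OF assms(2) that(2)]] neg[OF that(2)] by simp
qed

lemma riesz_subspace_max_min:
  assumes "riesz_subspace_of I R" "f \<in> R" "g \<in> R"
  shows "(\<lambda>x. max (f x) (g x)) \<in> R" and "(\<lambda>x. min (f x) (g x)) \<in> R"
proof -
  have R: "subspace R" and abs: "\<And>r. r \<in> R \<Longrightarrow> (\<lambda>x. \<bar>r x\<bar>) \<in> R"
    using assms(1) by (auto simp: riesz_subspace_of_def)
  note sub = subspace_pointwise[OF R]
  have "(\<lambda>x. (1/2) * ((f x + g x) + \<bar>f x - g x\<bar>)) \<in> R"
    by (intro sub abs assms)
  then show "(\<lambda>x. max (f x) (g x)) \<in> R"
    by (rule back_subst[where P = "\<lambda>h. h \<in> R"]) (auto simp: max_def)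
  have "(\<lambda>x. (1/2) * ((f x + g x) - \<bar>f x - g x\<bar>)) \<in> R"
    by (intro sub abs assms)
  then show "(\<lambda>x. min (f x) (g x)) \<in> R"
    by (rule back_subst[where P = "\<lambda>h. h \<in> R"]) (auto simp: min_def)
qed

lemma riesz_ideal_dominated:
  assumes "riesz_ideal I" "g \<in> I" "continuous_on UNIV f" "\<And>x. \<bar>f x\<bar> \<le> \<bar>g x\<bar>"
  shows "f \<in> I"
  using assms by (auto simp: riesz_ideal_def Cfun_def)

lemma riesz_ideal_bcontfun: "riesz_ideal (bcontfun :: ('a::topological_space \<Rightarrow> real) set)"
proof -
  have "subspace (bcontfun :: ('a \<Rightarrow> real) set)"
    by (auto simp: subspace_def zero_fun_def plus_fun_def scaleR_fun_def const_bcontfun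
        intro: plus_cont scaleR_cont[where 'b = real, simplified])
  moreover have "f \<in> bcontfun"
    if "f \<in> Cfun" "g \<in> bcontfun" "\<forall>x. \<bar>f x\<bar> \<le> \<bar>g x\<bar>" for f g :: "'a \<Rightarrow> real"
  proof -
    from that(2) obtain b where "\<And>x. norm (g x) \<le> b"
      by (auto simp: bcontfun_def bounded_iff)
    then show ?thesis
      using that by (intro bcontfun_normI[of f b]) (auto simp: Cfun_def intro: order_trans)
  qed
  ultimately show ?thesis
    by (auto simp: riesz_ideal_def Cfun_def bcontfun_def)
qed

section \<open>Monotone limits and strictly continuous maps\<close>

lemma decseq_pointwise: "decseq f \<longleftrightarrow> (\<forall>x. decseq (\<lambda>k. f k x))"
  for f :: "nat \<Rightarrow> 'a \<Rightarrow> real"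
  unfolding monotone_on_def le_fun_def by blast

lemma incseq_pointwise: "incseq f \<longleftrightarrow> (\<forall>x. incseq (\<lambda>k. f k x))"
  for f :: "nat \<Rightarrow> 'a \<Rightarrow> real"
  unfolding monotone_on_def le_fun_def by blast

text \<open>The definition of strict continuity speaks of infimum \<open>0\<close>; linearity moves it to an arbitrary
  limit \<open>g\<close>. The two conclusions say together that \<open>\<Phi> g\<close> is the infimum of the values \<open>\<Phi> (f k)\<close>.\<close>

lemma strictly_continuous_on_decseq_limit:
  fixes \<Phi> :: "('a \<Rightarrow> real) \<Rightarrow> 'v::ordered_real_vector"
  assumes I: "subspace I" and lin: "linear_map_on I \<Phi>" and cont: "strictly_continuous_on I \<Phi>"
    and fI: "\<And>k. f k \<in> I" and gI: "g \<in> I" and dec: "decseq f"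
    and lim: "\<And>x. (\<lambda>k. f k x) \<longlonglongrightarrow> g x"
  shows "\<Phi> g \<le> \<Phi> (f k)" and "(\<And>k. y \<le> \<Phi> (f k)) \<Longrightarrow> y \<le> \<Phi> g"
proof -
  let ?h = "\<lambda>k x. f k x - g x"
  have "decseq ?h"
    using dec unfolding decseq_pointwise by (auto simp: decseq_def)
  moreover have "isGlb UNIV (range (\<lambda>k. ?h k x)) 0" for x
  proof -
    have L: "(\<lambda>k. ?h k x) \<longlonglongrightarrow> 0"
      using tendsto_diff[OF lim[of x] tendsto_const[of "g x"]] by simp
    have "decseq (\<lambda>k. ?h k x)"
      using dec unfolding decseq_pointwise by (auto simp: decseq_def)
    then have "0 \<le> ?h k x" for k
      using L by (rule decseq_ge)
    moreover have "y \<le> 0" if "\<And>k. y \<le> ?h k x" for y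
      using LIMSEQ_le_const[OF L] that by blast
    ultimately show ?thesis
      by (auto simp: isGlb_def greatestP_def isLb_def setle_def setge_def)
  qed
  moreover have "range ?h \<subseteq> I"
    using subspace_pointwise(3)[OF I fI gI] by auto
  ultimately have "isGlb UNIV (range (\<lambda>k. \<Phi> (?h k))) 0"
    using cont unfolding strictly_continuous_on_def by blast
  then have glb: "isGlb UNIV (range (\<lambda>k. \<Phi> (f k) - \<Phi> g)) 0"
    using linear_map_on_pointwise(2)[OF lin I fI gI] by simp
  then show "\<Phi> g \<le> \<Phi> (f k)"
    by (auto simp: isGlb_def greatestP_def isLb_def setge_def)
  assume y: "\<And>k. y \<le> \<Phi> (f k)"
  then have "\<forall>k. y - \<Phi> g \<le> \<Phi> (f k) - \<Phi> g" by simp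
  moreover have "\<forall>z. (\<forall>k. z \<le> \<Phi> (f k) - \<Phi> g) \<longrightarrow> z \<le> 0"
    using glb by (auto simp: isGlb_def greatestP_def isLb_def setle_def setge_def)
  ultimately have "y - \<Phi> g \<le> 0" by blast
  then show "y \<le> \<Phi> g" by simp
qed

lemma agree_at_decseq_limit:
  fixes \<Phi> \<Psi> :: "('a \<Rightarrow> real) \<Rightarrow> 'v::ordered_real_vector"
  assumes "subspace I"
    and "linear_map_on I \<Phi>" "strictly_continuous_on I \<Phi>"
    and "linear_map_on I \<Psi>" "strictly_continuous_on I \<Psi>"
    and "\<And>k. f k \<in> I" "g \<in> I" "decseq f" "\<And>x. (\<lambda>k. f k x) \<longlonglongrightarrow> g x"
    and "\<And>k. \<Phi> (f k) = \<Psi> (f k)"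
  shows "\<Phi> g = \<Psi> g"
proof (rule antisym)
  show "\<Phi> g \<le> \<Psi> g"
    using strictly_continuous_on_decseq_limit[OF assms(1,2,3,6-9)]
      strictly_continuous_on_decseq_limit(2)[OF assms(1,4,5,6-9)] assms(10) by metis
  show "\<Psi> g \<le> \<Phi> g"
    using strictly_continuous_on_decseq_limit[OF assms(1,4,5,6-9)]
      strictly_continuous_on_decseq_limit(2)[OF assms(1,2,3,6-9)] assms(10) by metis
qed

text \<open>An ordered vector space need not be Archimedean, but the values of a strictly continuous map at
  nonnegative functions behave as in an Archimedean space, because \<open>c / n\<close> decreases to \<open>0\<close>.\<close>

lemma archimedean_on_range:
  fixes \<Phi> :: "('a \<Rightarrow> real) \<Rightarrow> 'v::ordered_real_vector"
  assumes I: "subspace I" and lin: "linear_map_on I \<Phi>" and cont: "strictly_continuous_on I \<Phi>"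
    and c: "c \<in> I" "\<And>x. 0 \<le> c x"
    and le: "\<And>n. y \<le> z + inverse (real (Suc n)) *\<^sub>R \<Phi> c"
  shows "y \<le> z"
proof -
  let ?f = "\<lambda>n x. inverse (real (Suc n)) * c x"
  have "decseq ?f"
    using c(2) unfolding decseq_pointwise by (auto simp: decseq_def intro!: mult_right_mono)
  moreover have "(\<lambda>n. ?f n x) \<longlonglongrightarrow> 0" for x
    by (rule tendsto_mult_left_zero[OF LIMSEQ_inverse_real_of_nat])
  moreover have "y - z \<le> \<Phi> (?f n)" for n
    using le[of n] by (simp only: linear_map_on_pointwise(3)[OF lin I c(1)] diff_le_eq add.commute)
  moreover have "?f n \<in> I" for n
    by (rule subspace_pointwise(4)[OF I c(1)])
  ultimately have "y - z \<le> \<Phi> (\<lambda>x. 0)"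
    using strictly_continuous_on_decseq_limit(2)[OF I lin cont, of ?f "\<lambda>x. 0"]
      subspace_pointwise(1)[OF I] by blast
  also have "\<Phi> (\<lambda>x. 0) = 0"
    using linear_map_on_pointwise(3)[OF lin I c(1), of 0] by simp
  finally show ?thesis by simp
qed

section \<open>Cutoff functions\<close>

lemma locally_compact_bump:
  fixes x :: "'a::t2_space"
  assumes "locally_compact_space (euclidean :: 'a topology)"
  obtains g :: "'a \<Rightarrow> real" and K where "continuous_on UNIV g" "\<And>y. 0 \<le> g y" "0 < g x"
    "compact K" "\<forall>y\<in>- K. g y = 0"
proof -
  have "Hausdorff_space (euclidean :: 'a topology)"
    unfolding Hausdorff_space_def disjnt_def by (metis hausdorff open_openin)
  then have "completely_regular_space (euclidean :: 'a topology)"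
    using assms locally_compact_regular_imp_completely_regular_space by blast
  moreover obtain U K where "open U" "compact K" "x \<in> U" "U \<subseteq> K"
    using assms unfolding locally_compact_space_def by (auto; meson)
  ultimately obtain f :: "'a \<Rightarrow> real" where
    f: "continuous_on UNIV f" "f x = 0" "f ` (- U) \<subseteq> {1}"
    unfolding completely_regular_space_alt'
    by (metis Compl_eq_Diff_UNIV continuous_map_iff_continuous2 open_openin topspace_euclidean)
  show thesis
  proof
    show "continuous_on UNIV (\<lambda>y. \<bar>1 - f y\<bar>)"
      by (intro continuous_intros f)
    show "\<forall>y\<in>- K. \<bar>1 - f y\<bar> = 0"
      using f(3) \<open>U \<subseteq> K\<close> by force
  qed (use f \<open>compact K\<close> in auto)
qed

text \<open>By the Lindelof property, countably many bump functions \<open>g\<^sub>i\<close> have no common zero. Hence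
  \<open>min 1 (n \<cdot> (g\<^sub>0 + \<dots> + g\<^sub>n\<^sub>-\<^sub>1))\<close> increases to \<open>1\<close>, and finite unions
  of the compact sets that carry the \<open>g\<^sub>i\<close> exhaust the space.\<close>

lemma compact_exhaustion_with_cutoffs:
  assumes "Lindelof_space (euclidean :: 'a::t2_space topology)"
    and "locally_compact_space (euclidean :: 'a::t2_space topology)"
  obtains \<phi> :: "nat \<Rightarrow> 'a::t2_space \<Rightarrow> real" and K :: "nat \<Rightarrow> 'a::t2_space set"
  where "\<And>n. continuous_on UNIV (\<phi> n)" "\<And>n x. 0 \<le> \<phi> n x" "\<And>n x. \<phi> n x \<le> 1"
    "incseq \<phi>" "\<And>x. (\<lambda>n. \<phi> n x) \<longlonglongrightarrow> 1"
    "\<And>n. compact (K n)" "\<And>n. \<forall>x\<in>- K n. \<phi> n x = 0"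
    "incseq K" "(\<Union>n. K n) = UNIV"
proof -
  define G where "G = {g :: 'a \<Rightarrow> real. continuous_on UNIV g \<and> (\<forall>y. 0 \<le> g y) \<and>
    (\<exists>K. compact K \<and> (\<forall>y. y \<notin> K \<longrightarrow> g y = 0))}"
  let ?P = "\<lambda>g :: 'a \<Rightarrow> real. {y. 0 < g y}"
  have "\<exists>g\<in>G. 0 < g x" for x
  proof -
    obtain g :: "'a \<Rightarrow> real" and K where g: "continuous_on UNIV g" "\<And>y. 0 \<le> g y" "0 < g x"
      "compact K" "\<forall>y\<in>- K. g y = 0"
      by (rule locally_compact_bump[OF assms(2), of x]) (assumption | rule that)+
    then have "g \<in> G" unfolding G_def by blast
    then show ?thesis using g(3) by blast
  qed
  then have "\<Union>(?P ` G) = UNIV" by auto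
  moreover have "open (?P g)" if "g \<in> G" for g
    using that by (auto simp: G_def intro!: open_Collect_less)
  ultimately obtain \<V> where V: "countable \<V>" "\<V> \<subseteq> ?P ` G" "\<Union>\<V> = UNIV"
    using assms(1)[unfolded Lindelof_space_def, rule_format, of "?P ` G"] by auto
  then obtain G' where G': "countable G'" "G' \<subseteq> G" "\<V> = ?P ` G'"
    using countable_subset_image[of \<V> ?P G] by blast
  have "G' \<noteq> {}" using V(3) G'(3) by auto
  define g where "g = from_nat_into G'"
  have range_g: "range g = G'"
    unfolding g_def by (rule range_from_nat_into[OF \<open>G' \<noteq> {}\<close> G'(1)])
  then have gG: "g n \<in> G" for n using G'(2) by auto
  then have cont: "continuous_on UNIV (g n)" and pos: "0 \<le> g n x" for n x
    by (auto simp: G_def)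
  have "\<forall>n. \<exists>K. compact K \<and> (\<forall>y. y \<notin> K \<longrightarrow> g n y = 0)"
    using gG by (auto simp: G_def)
  then obtain C where C: "\<And>n. compact (C n)" "\<And>n y. y \<notin> C n \<Longrightarrow> g n y = 0" by metis
  have ex: "\<exists>n. 0 < g n x" for x
    using V(3) G'(3) range_g by blast
  define S where "S = (\<lambda>n x. \<Sum>i<n. g i x)"
  define \<phi> where "\<phi> = (\<lambda>n x. min 1 (real n * S n x))"
  define K where "K = (\<lambda>n. \<Union>i<n. C i)"
  have S_pos: "0 \<le> S n x" for n x by (simp add: S_def pos sum_nonneg)
  have S_mono: "S m x \<le> S n x" if "m \<le> n" for m n x
    unfolding S_def using that pos by (intro sum_mono2) auto
  show thesis
  proof
    show "continuous_on UNIV (\<phi> n)" for n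
      unfolding \<phi>_def S_def by (intro continuous_intros cont)
    show "0 \<le> \<phi> n x" "\<phi> n x \<le> 1" for n x
      using S_pos by (auto simp: \<phi>_def)
    have "real m * S m x \<le> real n * S n x" if "m \<le> n" for m n x
      using that by (intro mult_mono S_mono S_pos) auto
    then show "incseq \<phi>"
      unfolding incseq_pointwise by (auto simp: incseq_def \<phi>_def intro: min.coboundedI2)
    show "(\<lambda>n. \<phi> n x) \<longlonglongrightarrow> 1" for x
    proof -
      obtain i where i: "0 < g i x" using ex by blast
      have S_i: "g i x \<le> S n x" if "i < n" for n
        unfolding S_def using that pos by (intro member_le_sum) auto
      obtain N where N: "1 < real N * g i x"
        using reals_Archimedean3[OF i] by blast
      have "\<phi> n x = 1" if "n \<ge> max (Suc i) N" for n
      proof -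
        have "real N * g i x \<le> real n * S n x"
          using that i S_i[of n] by (intro mult_mono) auto
        then show ?thesis using N by (simp add: \<phi>_def)
      qed
      then show ?thesis
        by (intro tendsto_eventually eventually_sequentiallyI)
    qed
    show "compact (K n)" for n
      unfolding K_def by (intro compact_UN C) auto
    show "\<forall>x\<in>- K n. \<phi> n x = 0" for n
      using C(2) by (simp add: \<phi>_def S_def K_def)
    show "incseq K"
      unfolding K_def incseq_def by (meson UN_mono lessThan_subset_iff order_refl)
    show "(\<Union>n. K n) = UNIV"
    proof -
      have "\<exists>n. x \<in> K n" for x
      proof -
        obtain i where "0 < g i x" using ex by blast
        then have "x \<in> K (Suc i)" using C(2)[of x i] by (auto simp: K_def)
        then show ?thesis ..
      qed
      then show ?thesis by auto
    qed
  qed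
qed

text \<open>For \<open>h \<ge> 0\<close> the products \<open>h \<cdot> \<phi>\<^sub>n\<close> lie in the ideal and increase to \<open>h\<close>; a general element is
  the difference of its positive and negative parts.\<close>

lemma agree_if_agree_on_compact_support:
  fixes I :: "('a::t2_space \<Rightarrow> real) set"
    and \<Phi> \<Psi> :: "('a \<Rightarrow> real) \<Rightarrow> 'v::ordered_real_vector"
  assumes "Lindelof_space (euclidean :: 'a topology)"
    and "locally_compact_space (euclidean :: 'a topology)"
    and ideal: "riesz_ideal I"
    and "linear_map_on I \<Phi>" "strictly_continuous_on I \<Phi>"
    and "linear_map_on I \<Psi>" "strictly_continuous_on I \<Psi>"
    and agree: "\<And>f K. f \<in> I \<Longrightarrow> (\<And>x. 0 \<le> f x) \<Longrightarrow> compact K \<Longrightarrow>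
      (\<And>x. x \<notin> K \<Longrightarrow> f x = 0) \<Longrightarrow> \<Phi> f = \<Psi> f"
    and f: "f \<in> I"
  shows "\<Phi> f = \<Psi> f"
proof -
  have I: "subspace I" using ideal by (simp add: riesz_ideal_def)
  obtain \<phi> :: "nat \<Rightarrow> 'a \<Rightarrow> real" and K :: "nat \<Rightarrow> 'a set"
    where \<phi>: "\<And>n. continuous_on UNIV (\<phi> n)" "\<And>n x. 0 \<le> \<phi> n x" "\<And>n x. \<phi> n x \<le> 1"
      "incseq \<phi>" "\<And>x. (\<lambda>n. \<phi> n x) \<longlonglongrightarrow> 1"
      and K: "\<And>n. compact (K n)" "\<And>n. \<forall>x\<in>- K n. \<phi> n x = 0"
      "incseq K" "(\<Union>n. K n) = UNIV"
    by (rule compact_exhaustion_with_cutoffs[OF assms(1,2)]) (rule that; assumption)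
  have nonneg: "\<Phi> h = \<Psi> h" if h: "h \<in> I" "\<And>x. 0 \<le> h x" for h
  proof -
    have "continuous_on UNIV h" using h(1) ideal by (auto simp: riesz_ideal_def Cfun_def)
    moreover have "\<bar>h x * \<phi> n x\<bar> \<le> \<bar>h x\<bar>" for n x
    proof -
      have "h x * \<phi> n x \<le> h x" by (rule mult_left_le[OF \<phi>(3) h(2)])
      then show ?thesis using \<phi>(2) h(2) by simp
    qed
    ultimately have hI: "(\<lambda>x. h x * \<phi> n x) \<in> I" for n
      by (intro riesz_ideal_dominated[OF ideal h(1)] continuous_intros \<phi>(1))
    have "\<Phi> (\<lambda>x. - h x) = \<Psi> (\<lambda>x. - h x)"
    proof (rule agree_at_decseq_limit[OF I assms(4-7)])
      show "(\<lambda>x. - (h x * \<phi> n x)) \<in> I" for n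
        by (intro subspace_pointwise[OF I] hI)
      show "decseq (\<lambda>n x. - (h x * \<phi> n x))"
        using \<phi>(4) h(2) unfolding decseq_pointwise incseq_pointwise
        by (auto simp: decseq_def incseq_def intro!: mult_left_mono)
      show "(\<lambda>n. - (h x * \<phi> n x)) \<longlonglongrightarrow> - h x" for x
        using tendsto_minus[OF tendsto_mult_left[OF \<phi>(5), of "h x"]] by simp
      show "\<Phi> (\<lambda>x. - (h x * \<phi> n x)) = \<Psi> (\<lambda>x. - (h x * \<phi> n x))" for n
        using agree[OF hI[of n] _ K(1)[of n]] h(2) \<phi>(2) K(2)
          linear_map_on_pointwise(4)[OF assms(4) I hI] linear_map_on_pointwise(4)[OF assms(6) I hI]
        by simp
    qed (use subspace_pointwise(5)[OF I] h(1) in auto)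
    then show ?thesis
      using linear_map_on_pointwise(4)[OF assms(4) I h(1)]
        linear_map_on_pointwise(4)[OF assms(6) I h(1)] by simp
  qed
  have fc: "continuous_on UNIV f" using f ideal by (auto simp: riesz_ideal_def Cfun_def)
  have p: "(\<lambda>x. max (f x) 0) \<in> I" and m: "(\<lambda>x. max (- f x) 0) \<in> I"
    by (rule riesz_ideal_dominated[OF ideal f]; auto intro!: continuous_intros fc)+
  have "(\<lambda>x. max (f x) 0 - max (- f x) 0) = f" by auto
  then show ?thesis
    using linear_map_on_pointwise(2)[OF assms(4) I p m] linear_map_on_pointwise(2)[OF assms(6) I p m]
      nonneg[OF p] nonneg[OF m] by simp
qed

section \<open>The case of a Riesz subspace\<close>

text \<open>A Dini-type argument: finitely many of the open sets where some \<open>r \<in> D\<close> lies below \<open>g\<close> cover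
  \<open>L\<close>, and a common lower bound in \<open>D\<close> of the corresponding functions works on all of \<open>L\<close>. Applied
  once downwards and once upwards, it replaces the two finite-cover steps in the classical proof of
  the lattice Stone--Weierstrass theorem.\<close>

lemma down_directed_below_on_compact:
  fixes D :: "('a::topological_space \<Rightarrow> real) set"
  assumes L: "compact L" and "D \<noteq> {}" and Dc: "\<And>r. r \<in> D \<Longrightarrow> continuous_on UNIV r"
    and g: "continuous_on UNIV g"
    and min: "\<And>r s. r \<in> D \<Longrightarrow> s \<in> D \<Longrightarrow> (\<lambda>x. min (r x) (s x)) \<in> D"
    and below: "\<And>x. x \<in> L \<Longrightarrow> \<exists>r\<in>D. r x < g x"
  shows "\<exists>r\<in>D. \<forall>x\<in>L. r x < g x"
proof -
  have op: "\<And>r. r \<in> D \<Longrightarrow> open {x. r x < g x}"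
    using Dc g by (intro open_Collect_less) auto
  have cov: "L \<subseteq> (\<Union>r\<in>D. {x. r x < g x})" using below by blast
  obtain F where F: "F \<subseteq> D" "finite F" "L \<subseteq> (\<Union>r\<in>F. {x. r x < g x})"
    using compactE_image[OF L op cov] by blast
  have "\<exists>r\<in>D. \<forall>s\<in>F. \<forall>x. r x \<le> s x"
    using F(2,1)
  proof (induction F)
    case empty
    then show ?case using \<open>D \<noteq> {}\<close> by auto
  next
    case (insert s F)
    then obtain r where r: "r \<in> D" "\<forall>s\<in>F. \<forall>x. r x \<le> s x" by auto
    have "(\<lambda>x. min (r x) (s x)) \<in> D"
      using r(1) insert.prems by (intro min) auto
    moreover have "\<forall>t\<in>insert s F. \<forall>x. min (r x) (s x) \<le> t x"
      using r(2) by (auto intro: min.coboundedI1)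
    ultimately show ?case by (intro bexI[where x = "\<lambda>x. min (r x) (s x)"])
  qed
  then obtain r where r: "r \<in> D" "\<forall>s\<in>F. \<forall>x. r x \<le> s x" by blast
  have "r x < g x" if "x \<in> L" for x
  proof -
    obtain s where "s \<in> F" "s x < g x" using F(3) \<open>x \<in> L\<close> by blast
    then show ?thesis using r(2) by (meson le_less_trans)
  qed
  then show ?thesis using r(1) by blast
qed

lemma up_directed_above_on_compact:
  fixes D :: "('a::topological_space \<Rightarrow> real) set"
  assumes L: "compact L" and "D \<noteq> {}" and Dc: "\<And>r. r \<in> D \<Longrightarrow> continuous_on UNIV r"
    and g: "continuous_on UNIV g"
    and max: "\<And>r s. r \<in> D \<Longrightarrow> s \<in> D \<Longrightarrow> (\<lambda>x. max (r x) (s x)) \<in> D"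
    and above: "\<And>x. x \<in> L \<Longrightarrow> \<exists>r\<in>D. g x < r x"
  shows "\<exists>r\<in>D. \<forall>x\<in>L. g x < r x"
proof -
  let ?N = "(\<lambda>r x. - r x) ` D"
  have "\<exists>r\<in>?N. \<forall>x\<in>L. r x < - g x"
  proof (rule down_directed_below_on_compact[OF L])
    show "(\<lambda>x. min (r x) (s x)) \<in> ?N" if "r \<in> ?N" "s \<in> ?N" for r s
    proof -
      obtain r' s' where rs: "r' \<in> D" "s' \<in> D" "r = (\<lambda>x. - r' x)" "s = (\<lambda>x. - s' x)"
        using \<open>r \<in> ?N\<close> \<open>s \<in> ?N\<close> by blast
      then have "(\<lambda>x. min (r x) (s x)) = (\<lambda>x. - max (r' x) (s' x))"
        by (simp add: minus_max_eq_min)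
      then show ?thesis
        using max[OF rs(1,2)] by (intro image_eqI[where x = "\<lambda>x. max (r' x) (s' x)"])
    qed
    show "\<exists>r\<in>?N. r x < - g x" if "x \<in> L" for x
      using above[OF that] by auto
    show "continuous_on UNIV r" if "r \<in> ?N" for r
      using that Dc by (auto intro!: continuous_on_minus)
    show "continuous_on UNIV (\<lambda>x. - g x)"
      by (intro continuous_on_minus g)
  qed (use \<open>D \<noteq> {}\<close> in simp)
  then show ?thesis by auto
qed

lemma strictly_point_separating_mono:
  "S \<subseteq> T \<Longrightarrow> strictly_point_separating S \<Longrightarrow> strictly_point_separating T"
  unfolding strictly_point_separating_def by (meson subsetD)

lemma nowhere_vanishing_mono: "S \<subseteq> T \<Longrightarrow> nowhere_vanishing S \<Longrightarrow> nowhere_vanishing T"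
  unfolding nowhere_vanishing_def by (meson subsetD)

text \<open>The conditional covers the diagonal, where only one value can be prescribed: off the diagonal
  strict separation yields functions that vanish at exactly one chosen point of the two; on it,
  nowhere vanishing is what is needed.\<close>

lemma interpolate_two_points:
  fixes R :: "('a \<Rightarrow> real) set"
  assumes R: "subspace R" and "strictly_point_separating R" "nowhere_vanishing R"
  shows "\<exists>r\<in>R. r x = a \<and> r y = (if x = y then a else b)"
proof (cases "x = y")
  case True
  obtain s where "s \<in> R" "s x \<noteq> 0" using assms(3) by (auto simp: nowhere_vanishing_def)
  then show ?thesis using True
    by (intro bexI[OF _ subspace_pointwise(4)[OF R, of s "a / s x"]]) auto
next
  case False
  obtain s where s: "s \<in> R" "s x \<noteq> 0" "s y = 0"
    using assms(2) False unfolding strictly_point_separating_def by blast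
  obtain t where t: "t \<in> R" "t y \<noteq> 0" "t x = 0"
    using assms(2) False unfolding strictly_point_separating_def by metis
  have "(\<lambda>z. (a / s x) * s z + (b / t y) * t z) \<in> R"
    by (intro subspace_pointwise[OF R] s t)
  then show ?thesis using False s t by (intro bexI) auto
qed

text \<open>The lattice form of the Stone--Weierstrass theorem. With \<open>x\<close> fixed, the functions of \<open>R\<close> that
  exceed \<open>g - e\<close> at \<open>x\<close> are closed under minima and can be pushed below \<open>g + e\<close> on \<open>L\<close>; the functions
  so obtained are closed under maxima and can be raised above \<open>g - e\<close> on \<open>L\<close>.\<close>

lemma riesz_subspace_dense_on_compact:
  fixes R :: "('a::topological_space \<Rightarrow> real) set"
  assumes R: "riesz_subspace_of Cfun R" "strictly_point_separating R" "nowhere_vanishing R"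
    and L: "compact L" and g: "continuous_on UNIV g" and e: "0 < e"
  shows "\<exists>r\<in>R. \<forall>x\<in>L. g x - e < r x \<and> r x < g x + e"
proof -
  have sub: "subspace R" and Rc: "\<And>r. r \<in> R \<Longrightarrow> continuous_on UNIV r"
    using R(1) by (auto simp: riesz_subspace_of_def Cfun_def)
  note maxmin = riesz_subspace_max_min[OF R(1)]
  have one: "\<exists>r\<in>R. g x - e < r x \<and> (\<forall>y\<in>L. r y < g y + e)" for x
  proof -
    let ?D = "{r\<in>R. g x - e < r x}"
    have inter: "\<exists>r\<in>?D. r y < g y + e" for y
      using interpolate_two_points[OF sub R(2,3), of x "g x" y "g y"] e by (force split: if_splits)
    moreover have "?D \<noteq> {}"
      using inter by blast
    ultimately have "\<exists>r\<in>?D. \<forall>y\<in>L. r y < g y + e"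
      using maxmin g e
      by (intro down_directed_below_on_compact[OF L])
        (auto simp: Rc intro!: continuous_intros)
    then show ?thesis by blast
  qed
  let ?E = "{r\<in>R. \<forall>y\<in>L. r y < g y + e}"
  have "?E \<noteq> {}" and "\<And>x. \<exists>r\<in>?E. g x - e < r x"
    using one by blast+
  then have "\<exists>r\<in>?E. \<forall>x\<in>L. g x - e < r x"
    using maxmin g
    by (intro up_directed_above_on_compact[OF L])
      (auto simp: Rc intro!: continuous_intros)
  then show ?thesis by blast
qed

text \<open>Density on compact sets gives no control elsewhere. For \<open>f \<ge> 0\<close> of compact support the positive
  part supplies the missing half: off the support, \<open>f = 0\<close> is below every nonnegative function.
  An upper estimate is needed only at each point eventually, hence on the members of an exhaustion.\<close>

lemma riesz_subspace_decseq_to_compact_support: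
  fixes R :: "('a::topological_space \<Rightarrow> real) set"
  assumes R: "riesz_subspace_of Cfun R" "strictly_point_separating R" "nowhere_vanishing R"
    and K: "\<And>n. compact (K n :: 'a set)" "incseq K" "(\<Union>n. K n) = UNIV"
    and f: "continuous_on UNIV f" "\<And>x. 0 \<le> f x" "compact C" "\<And>x. x \<notin> C \<Longrightarrow> f x = 0"
  obtains s :: "nat \<Rightarrow> 'a \<Rightarrow> real"
  where "\<And>n. s n \<in> R" "decseq s" "\<And>x. (\<lambda>n. s n x) \<longlonglongrightarrow> f x"
proof -
  have sub: "subspace R" using R(1) by (simp add: riesz_subspace_of_def)
  have "\<exists>r\<in>R. (\<forall>x. f x \<le> r x) \<and> (\<forall>x\<in>K n. r x \<le> f x + inverse (real (Suc n)))" for n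
  proof -
    \<comment> \<open>Approximating \<open>f + e\<close> within \<open>e\<close> places \<open>r\<close> strictly between \<open>f\<close> and \<open>f + 2 e\<close>.\<close>
    define e where "e = inverse (real (Suc n)) / 2"
    have e: "0 < e" by (simp add: e_def)
    have "\<exists>r\<in>R. \<forall>x\<in>C \<union> K n. (f x + e) - e < r x \<and> r x < (f x + e) + e"
      by (rule riesz_subspace_dense_on_compact[OF R _ _ e])
        (use f K in \<open>auto intro!: continuous_intros\<close>)
    then obtain r where r: "r \<in> R" "\<And>x. x \<in> C \<union> K n \<Longrightarrow> f x < r x \<and> r x < f x + 2 * e"
      by (auto simp: algebra_simps)
    have "f x \<le> max (r x) 0" for x
      using r(2)[of x] f(4)[of x] by (cases "x \<in> C") auto
    moreover have "max (r x) 0 \<le> f x + inverse (real (Suc n))" if "x \<in> K n" for x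
      using r(2)[of x] f(2)[of x] that e unfolding e_def by auto
    ultimately show ?thesis
      by (intro bexI[OF _ riesz_subspace_max_min(1)[OF R(1) r(1) subspace_pointwise(1)[OF sub]]])
        blast
  qed
  then obtain r where r: "\<And>n. r n \<in> R" "\<And>n x. f x \<le> r n x"
    "\<And>n x. x \<in> K n \<Longrightarrow> r n x \<le> f x + inverse (real (Suc n))" by metis
  define s where "s = rec_nat (r 0) (\<lambda>n h x. min (h x) (r (Suc n) x))"
  have s: "s 0 = r 0" "s (Suc n) = (\<lambda>x. min (s n x) (r (Suc n) x))" for n
    by (simp_all add: s_def)
  show thesis
  proof
    show "s n \<in> R" for n
      by (induction n) (simp_all add: s r riesz_subspace_max_min[OF R(1)])
    show "decseq s"
      by (rule decseq_SucI) (simp add: s le_fun_def)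
    fix x
    have lower: "f x \<le> s n x" for n
      by (induction n) (simp_all add: s r)
    have upper: "s n x \<le> r n x" for n
      by (cases n) (simp_all add: s)
    obtain m where m: "x \<in> K m" using K(3) by blast
    have "s n x \<le> f x + inverse (real (Suc n))" if "m \<le> n" for n
      using upper[of n] r(3)[of x n] m K(2) that by (fastforce simp: incseq_def)
    then have eventually_upper: "\<forall>\<^sub>F n in sequentially. s n x \<le> f x + inverse (real (Suc n))"
      by (rule eventually_sequentiallyI)
    have upper_limit: "(\<lambda>n. f x + inverse (real (Suc n))) \<longlonglongrightarrow> f x"
      using tendsto_add[OF tendsto_const LIMSEQ_inverse_real_of_nat] by simp
    show "(\<lambda>n. s n x) \<longlonglongrightarrow> f x"
      by (rule tendsto_sandwich[OF always_eventually eventually_upper tendsto_const upper_limit])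
        (simp add: lower)
  qed
qed

lemma agree_if_agree_on_riesz_subspace:
  fixes I :: "('a::t2_space \<Rightarrow> real) set"
    and \<Phi> \<Psi> :: "('a \<Rightarrow> real) \<Rightarrow> 'v::ordered_real_vector"
  assumes "Lindelof_space (euclidean :: 'a topology)"
    and "locally_compact_space (euclidean :: 'a topology)"
    and ideal: "riesz_ideal I"
    and "linear_map_on I \<Phi>" "strictly_continuous_on I \<Phi>"
    and "linear_map_on I \<Psi>" "strictly_continuous_on I \<Psi>"
    and R: "riesz_subspace_of I R" "strictly_point_separating R" "nowhere_vanishing R"
    and agree: "\<And>r. r \<in> R \<Longrightarrow> \<Phi> r = \<Psi> r"
    and "f \<in> I"
  shows "\<Phi> f = \<Psi> f"
proof (rule agree_if_agree_on_compact_support[OF assms(1-7) _ \<open>f \<in> I\<close>])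
  fix f C
  assume f: "f \<in> I" "\<And>x. 0 \<le> f x" "compact C" "\<And>x. x \<notin> C \<Longrightarrow> f x = 0"
  have I: "subspace I" "I \<subseteq> Cfun" using ideal by (simp_all add: riesz_ideal_def)
  have RI: "R \<subseteq> I" and RC: "riesz_subspace_of Cfun R"
    using R(1) I(2) by (auto simp: riesz_subspace_of_def)
  obtain \<phi> :: "nat \<Rightarrow> 'a \<Rightarrow> real" and K :: "nat \<Rightarrow> 'a set"
    where \<phi>: "\<And>n. continuous_on UNIV (\<phi> n)" "\<And>n x. 0 \<le> \<phi> n x" "\<And>n x. \<phi> n x \<le> 1"
      "incseq \<phi>" "\<And>x. (\<lambda>n. \<phi> n x) \<longlonglongrightarrow> 1"
      and K: "\<And>n. compact (K n)" "\<And>n. \<forall>x\<in>- K n. \<phi> n x = 0"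
      "incseq K" "(\<Union>n. K n) = UNIV"
    by (rule compact_exhaustion_with_cutoffs[OF assms(1,2)]) (rule that; assumption)
  have fc: "continuous_on UNIV f" using f(1) I(2) by (auto simp: Cfun_def)
  obtain s :: "nat \<Rightarrow> 'a \<Rightarrow> real"
    where s: "\<And>n. s n \<in> R" "decseq s" "\<And>x. (\<lambda>n. s n x) \<longlonglongrightarrow> f x"
    by (rule riesz_subspace_decseq_to_compact_support[OF RC R(2,3) K(1,3,4) fc f(2-4)])
      (assumption | rule that)+
  show "\<Phi> f = \<Psi> f"
    using s RI agree by (intro agree_at_decseq_limit[OF I(1) assms(4-7) _ f(1)]) auto
qed

section \<open>The case of a subalgebra\<close>

definition uniform_closure :: "('a::topological_space \<Rightarrow> real) set \<Rightarrow> ('a \<Rightarrow> real) set" where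
  "uniform_closure B = {f\<in>bcontfun. \<forall>e>0. \<exists>b\<in>B. \<forall>x. \<bar>f x - b x\<bar> \<le> e}"

lemma subset_uniform_closure: "B \<subseteq> bcontfun \<Longrightarrow> B \<subseteq> uniform_closure B"
  by (force simp: uniform_closure_def)

lemma subalgebra_ofD:
  assumes "subalgebra_of A B"
  shows "subspace B" and "B \<subseteq> A" and "f \<in> B \<Longrightarrow> g \<in> B \<Longrightarrow> (\<lambda>x. f x * g x) \<in> B"
  using assms by (auto simp: subalgebra_of_def times_fun_def)

text \<open>A subalgebra without unit is closed only under polynomials that vanish at \<open>0\<close>, so the constant
  term is subtracted.\<close>

lemma subalgebra_polynomial:
  assumes alg: "subalgebra_of A B" and b: "b \<in> B" and p: "real_polynomial_function p"
  shows "(\<lambda>x. p (b x) - p 0) \<in> B"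
  using p
proof (induction p)
  case (linear p)
  then have "p = (\<lambda>t. p 1 * t)"
    by (metis linear_simps(5) mult.commute mult.right_neutral real_scaleR_def)
  then obtain c where "p = (\<lambda>t. c * t)" by blast
  then show ?case using subspace_pointwise(4)[OF subalgebra_ofD(1)[OF alg] b] by simp
next
  case (const c)
  then show ?case using subspace_pointwise(1)[OF subalgebra_ofD(1)[OF alg]] by simp
next
  case (add p q)
  show ?case using subspace_pointwise(2)[OF subalgebra_ofD(1)[OF alg] add.IH] by (simp add: algebra_simps)
next
  case (mult p q)
  let ?p = "\<lambda>x. p (b x) - p 0" and ?q = "\<lambda>x. q (b x) - q 0"
  have "(\<lambda>x. ?p x * ?q x + (q 0 * ?p x + p 0 * ?q x)) \<in> B"
    by (intro subspace_pointwise[OF subalgebra_ofD(1)[OF alg]] subalgebra_ofD(3)[OF alg] mult.IH)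
  then show ?case by (simp add: algebra_simps)
qed

text \<open>Weierstrass approximation of \<open>\<bar>t\<bar>\<close> on the range of \<open>b\<close>, within \<open>e / 2\<close>; since \<open>\<bar>t\<bar>\<close> vanishes
  at \<open>0\<close>, dropping the constant term of the polynomial costs at most another \<open>e / 2\<close>.\<close>

lemma subalgebra_approximates_abs:
  fixes B :: "('a::topological_space \<Rightarrow> real) set"
  assumes alg: "subalgebra_of bcontfun B" and b: "b \<in> B" and e: "0 < e"
  shows "\<exists>a\<in>B. \<forall>x. \<bar>\<bar>b x\<bar> - a x\<bar> \<le> e"
proof -
  obtain M where M: "\<And>x. \<bar>b x\<bar> \<le> M"
    using b subalgebra_ofD(2)[OF alg] by (auto simp: bcontfun_def bounded_iff)
  then have "0 \<le> M" using abs_ge_zero order_trans by blast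
  have "continuous_on {-M..M} (\<lambda>t::real. \<bar>t\<bar>)" by (intro continuous_intros)
  then obtain p where p: "real_polynomial_function p"
    "\<And>t. t \<in> {-M..M} \<Longrightarrow> \<bar>\<bar>t\<bar> - p t\<bar> < e / 2"
    using Stone_Weierstrass_real_polynomial_function[of "{-M..M}" "\<lambda>t. \<bar>t\<bar>" "e/2"] e by auto
  have le: "\<bar>\<bar>b x\<bar> - (p (b x) - p 0)\<bar> \<le> e" for x
  proof -
    have "b x \<in> {-M..M}" using M[of x] by (auto simp: abs_le_iff)
    then have "\<bar>\<bar>b x\<bar> - p (b x)\<bar> < e / 2" by (rule p(2))
    moreover have "\<bar>p 0\<bar> < e / 2" using p(2)[of 0] \<open>0 \<le> M\<close> by simp
    ultimately show ?thesis by linarith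
  qed
  show ?thesis
    by (intro bexI[OF _ subalgebra_polynomial[OF alg b p(1)]] allI le)
qed

text \<open>For the absolute value of \<open>f\<close>, approximate \<open>f\<close> by \<open>a \<in> B\<close> and then \<open>\<bar>a\<bar>\<close>, which need not lie
  in \<open>B\<close>, by an element of \<open>B\<close>.\<close>

lemma riesz_subspace_uniform_closure:
  fixes B :: "('a::topological_space \<Rightarrow> real) set"
  assumes alg: "subalgebra_of bcontfun B"
  shows "riesz_subspace_of bcontfun (uniform_closure B)"
proof -
  note B = subalgebra_ofD(1)[OF alg] and Bb = subalgebra_ofD(2)[OF alg]
  have bI: "subspace (bcontfun :: ('a \<Rightarrow> real) set)"
    using riesz_ideal_bcontfun[where 'a = 'a] by (simp add: riesz_ideal_def)
  have app: "\<And>e. 0 < e \<Longrightarrow> \<exists>b\<in>B. \<forall>x. \<bar>f x - b x\<bar> \<le> e" if "f \<in> uniform_closure B" for f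
    using that by (simp add: uniform_closure_def)
  have cb: "f \<in> bcontfun" if "f \<in> uniform_closure B" for f
    using that by (simp add: uniform_closure_def)
  have "(\<lambda>x. f x + g x) \<in> uniform_closure B"
    if f: "f \<in> uniform_closure B" and g: "g \<in> uniform_closure B" for f g
  proof -
    have "\<exists>b\<in>B. \<forall>x. \<bar>(f x + g x) - b x\<bar> \<le> e" if e: "e > 0" for e
    proof -
      obtain a b where a: "a \<in> B" "\<And>x. \<bar>f x - a x\<bar> \<le> e/2" and b: "b \<in> B" "\<And>x. \<bar>g x - b x\<bar> \<le> e/2"
        using app[OF f, of "e/2"] app[OF g, of "e/2"] e by auto
      have le: "\<bar>(f x + g x) - (a x + b x)\<bar> \<le> e" for x using a(2)[of x] b(2)[of x] by linarith
      show ?thesis by (intro bexI[OF _ subspace_pointwise(2)[OF B a(1) b(1)]] allI le)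
    qed
    then show ?thesis using plus_cont[OF cb[OF f] cb[OF g]] by (simp add: uniform_closure_def)
  qed
  moreover have "(\<lambda>x. c * f x) \<in> uniform_closure B" if f: "f \<in> uniform_closure B" for f c
  proof -
    have "\<exists>b\<in>B. \<forall>x. \<bar>c * f x - b x\<bar> \<le> e" if e: "e > 0" for e
    proof -
      let ?d = "e / (\<bar>c\<bar> + 1)"
      have d: "0 < ?d" using e by (intro divide_pos_pos) auto
      obtain a where a: "a \<in> B" "\<And>x. \<bar>f x - a x\<bar> \<le> ?d" using app[OF f d] by auto
      have le: "\<bar>c * f x - c * a x\<bar> \<le> e" for x
      proof -
        have "\<bar>c * f x - c * a x\<bar> = \<bar>c\<bar> * \<bar>f x - a x\<bar>" by (simp add: abs_mult[symmetric] algebra_simps)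
        also have "\<dots> \<le> (\<bar>c\<bar> + 1) * ?d" by (intro mult_mono a) auto
        also have "\<dots> = e" by simp
        finally show ?thesis .
      qed
      show ?thesis by (intro bexI[OF _ subspace_pointwise(4)[OF B a(1), of c]] allI le)
    qed
    then show ?thesis using subspace_pointwise(4)[OF bI cb[OF f]] by (simp add: uniform_closure_def)
  qed
  moreover have "(\<lambda>x. 0) \<in> uniform_closure B"
    using subset_uniform_closure[OF Bb] subspace_pointwise(1)[OF B] by blast
  ultimately have "subspace (uniform_closure B)"
    by (simp add: subspace_def zero_fun_def plus_fun_def scaleR_fun_def)
  moreover have "(\<lambda>x. \<bar>f x\<bar>) \<in> uniform_closure B" if f: "f \<in> uniform_closure B" for f
  proof -
    have "\<exists>b\<in>B. \<forall>x. \<bar>\<bar>f x\<bar> - b x\<bar> \<le> e" if e: "e > 0" for e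
    proof -
      obtain a where a: "a \<in> B" "\<And>x. \<bar>f x - a x\<bar> \<le> e/2" using app[OF f, of "e/2"] e by auto
      obtain b where b: "b \<in> B" "\<And>x. \<bar>\<bar>a x\<bar> - b x\<bar> \<le> e/2"
        using subalgebra_approximates_abs[OF alg a(1), of "e/2"] e by auto
      have "\<bar>\<bar>f x\<bar> - b x\<bar> \<le> e" for x using a(2)[of x] b(2)[of x] by linarith
      then show ?thesis using b(1) by blast
    qed
    moreover have "(\<lambda>x. \<bar>f x\<bar>) \<in> bcontfun"
      using cb[OF f] by (intro riesz_ideal_dominated[OF riesz_ideal_bcontfun cb[OF f]])
        (auto simp: bcontfun_def intro!: continuous_intros)
    ultimately show ?thesis by (simp add: uniform_closure_def)
  qed
  ultimately show ?thesis
    using cb by (auto simp: riesz_subspace_of_def)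
qed

lemma riesz_ideal_mult_bcontfun:
  assumes I: "riesz_ideal I" and c: "c \<in> I" and h: "h \<in> bcontfun"
  shows "(\<lambda>x. c x * h x) \<in> I"
proof -
  obtain M where M: "\<And>x. \<bar>h x\<bar> \<le> M" using h by (auto simp: bcontfun_def bounded_iff)
  then have M0: "0 \<le> M" using abs_ge_zero order_trans by blast
  have "(\<lambda>x. M * c x) \<in> I"
    using I c subspace_pointwise(4) by (auto simp: riesz_ideal_def)
  then show ?thesis
  proof (rule riesz_ideal_dominated[OF I])
    show "continuous_on UNIV (\<lambda>x. c x * h x)"
      using I c h by (auto simp: riesz_ideal_def Cfun_def bcontfun_def intro!: continuous_intros)
    show "\<bar>c x * h x\<bar> \<le> \<bar>M * c x\<bar>" for x
      using mult_right_mono[OF M[of x], of "\<bar>c x\<bar>"] M0 by (simp add: abs_mult mult.commute)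
  qed
qed

text \<open>Localisation at \<open>c\<close>: multiplication by \<open>c\<close> takes every bounded continuous function into the
  ideal and preserves decreasing sequences with infimum \<open>0\<close>.\<close>

lemma multiplied_map_strictly_continuous:
  fixes \<Phi> :: "('a::topological_space \<Rightarrow> real) \<Rightarrow> 'v::ordered_real_vector"
  assumes ideal: "riesz_ideal I" and lin: "linear_map_on I \<Phi>" and cont: "strictly_continuous_on I \<Phi>"
    and c: "c \<in> I" "\<And>x. 0 \<le> c x"
  shows "linear_map_on bcontfun (\<lambda>h. \<Phi> (\<lambda>x. c x * h x))"
    and "strictly_continuous_on bcontfun (\<lambda>h. \<Phi> (\<lambda>x. c x * h x))"
proof -
  have I: "subspace I" using ideal by (simp add: riesz_ideal_def)
  note cI = riesz_ideal_mult_bcontfun[OF ideal c(1)]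
  show "linear_map_on bcontfun (\<lambda>h. \<Phi> (\<lambda>x. c x * h x))"
    unfolding linear_map_on_def
  proof (intro conjI ballI allI)
    fix f g :: "'a \<Rightarrow> real" and a :: real assume f: "f \<in> bcontfun"
    show "\<Phi> (\<lambda>x. c x * (a *\<^sub>R f) x) = a *\<^sub>R \<Phi> (\<lambda>x. c x * f x)"
      using linear_map_on_pointwise(3)[OF lin I cI[OF f], of a]
      by (simp add: mult.left_commute)
    assume g: "g \<in> bcontfun"
    show "\<Phi> (\<lambda>x. c x * (f + g) x) = \<Phi> (\<lambda>x. c x * f x) + \<Phi> (\<lambda>x. c x * g x)"
      using linear_map_on_pointwise(1)[OF lin I cI[OF f] cI[OF g]]
      by (simp add: distrib_left)
  qed
  show "strictly_continuous_on bcontfun (\<lambda>h. \<Phi> (\<lambda>x. c x * h x))"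
    unfolding strictly_continuous_on_def
  proof (intro allI impI, elim conjE)
    fix f :: "nat \<Rightarrow> 'a \<Rightarrow> real"
    assume f: "range f \<subseteq> bcontfun" "decseq f" "\<forall>x. isGlb UNIV (range (\<lambda>k. f k x)) 0"
    have lim: "(\<lambda>k. f k x) \<longlonglongrightarrow> 0" for x
    proof -
      have glb: "\<And>k. 0 \<le> f k x" "\<And>y. (\<And>k. y \<le> f k x) \<Longrightarrow> y \<le> 0"
        using f(3) by (auto simp: isGlb_def greatestP_def isLb_def setle_def setge_def)
      have dec: "decseq (\<lambda>k. f k x)" using f(2) by (simp add: decseq_pointwise)
      then obtain l where l: "(\<lambda>k. f k x) \<longlonglongrightarrow> l" using glb(1) decseq_convergent by metis
      have "l \<le> 0" using glb(2)[of l] decseq_ge[OF dec l] by blast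
      moreover have "0 \<le> l" using LIMSEQ_le_const[OF l] glb(1) by blast
      ultimately show ?thesis using l by simp
    qed
    let ?g = "\<lambda>k x. c x * f k x"
    have gI: "?g k \<in> I" for k using cI f(1) by auto
    have dec: "decseq ?g" 
      using f(2) c(2) unfolding decseq_pointwise by (auto simp: decseq_def intro!: mult_left_mono)
    have lim: "(\<lambda>k. ?g k x) \<longlonglongrightarrow> 0" for x
      using tendsto_mult_left[OF lim, of "c x"] by simp
    note limit = strictly_continuous_on_decseq_limit[OF I lin cont gI subspace_pointwise(1)[OF I] dec lim]
    have "\<Phi> (\<lambda>x. 0) = 0"
      using linear_map_on_pointwise(3)[OF lin I c(1), of 0] by simp
    then show "isGlb UNIV (range (\<lambda>k. \<Phi> (?g k))) 0"
      using limit by (auto simp: isGlb_def greatestP_def isLb_def setle_def setge_def)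
  qed
qed

text \<open>If \<open>\<bar>h - b\<bar> \<le> e\<close>, then \<open>\<bar>c \<cdot> h - c \<cdot> b\<bar> \<le> e \<cdot> c\<close>, so by positivity the values of \<open>\<Phi>\<close> and \<open>\<Psi>\<close> at
  \<open>c \<cdot> h\<close> differ by at most \<open>e (\<Phi> c + \<Psi> c)\<close>. Only one inequality is stated, as the hypotheses are
  symmetric in the two maps.\<close>

lemma le_at_uniform_limit_multiplied:
  fixes \<Phi> \<Psi> :: "('a::topological_space \<Rightarrow> real) \<Rightarrow> 'v::ordered_real_vector"
  assumes ideal: "riesz_ideal I"
    and pos: "positive_linear_map_on I \<Phi>" "positive_linear_map_on I \<Psi>"
    and cont: "strictly_continuous_on I \<Phi>" "strictly_continuous_on I \<Psi>"
    and c: "c \<in> I" "\<And>x. 0 \<le> c x"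
    and h: "h \<in> uniform_closure B"
    and cB: "\<And>b. b \<in> B \<Longrightarrow> (\<lambda>x. c x * b x) \<in> I"
    and agree: "\<And>b. b \<in> B \<Longrightarrow> \<Phi> (\<lambda>x. c x * b x) = \<Psi> (\<lambda>x. c x * b x)"
  shows "\<Phi> (\<lambda>x. c x * h x) \<le> \<Psi> (\<lambda>x. c x * h x)"
proof -
  have I: "subspace I" using ideal by (simp add: riesz_ideal_def)
  have lin: "linear_map_on I \<Phi>" "linear_map_on I \<Psi>"
    using pos by (auto simp: positive_linear_map_on_def)
  have mono: "\<Theta> f \<le> \<Theta> g" if \<Theta>: "positive_linear_map_on I \<Theta>" and fg: "f \<in> I" "g \<in> I" "\<And>x. f x \<le> g x"
    for f g and \<Theta> :: "('a \<Rightarrow> real) \<Rightarrow> 'v"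
  proof -
    have "0 \<le> \<Theta> (\<lambda>x. g x - f x)"
      using \<Theta> subspace_pointwise(3)[OF I fg(2,1)] fg(3)
      by (auto simp: positive_linear_map_on_def le_fun_def)
    also have "\<dots> = \<Theta> g - \<Theta> f"
      using \<Theta> linear_map_on_pointwise(2)[OF _ I fg(2,1)] by (auto simp: positive_linear_map_on_def)
    finally show ?thesis by simp
  qed
  let ?h = "\<lambda>x. c x * h x"
  have hI: "?h \<in> I"
    using h by (intro riesz_ideal_mult_bcontfun[OF ideal c(1)]) (simp add: uniform_closure_def)
  have bound: "\<Phi> ?h \<le> \<Psi> ?h + e *\<^sub>R \<Phi> c + e *\<^sub>R \<Psi> c" if e: "0 < e" for e
  proof -
    obtain b where b: "b \<in> B" "\<And>x. \<bar>h x - b x\<bar> \<le> e" using h e by (auto simp: uniform_closure_def)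
    let ?b = "\<lambda>x. c x * b x" and ?e = "\<lambda>x. e * c x"
    have eI: "?e \<in> I" by (rule subspace_pointwise(4)[OF I c(1)])
    have le: "?h x \<le> ?b x + ?e x" "?b x \<le> ?h x + ?e x" for x
      using mult_left_mono[OF b(2)[of x] c(2)[of x]] c(2)[of x]
        abs_mult[of "c x" "h x - b x"] by (simp_all add: algebra_simps)
    have "\<Phi> ?h \<le> \<Phi> (\<lambda>x. ?b x + ?e x)"
      by (intro mono[OF pos(1)] hI subspace_pointwise[OF I] cB b eI le c)
    also have "\<dots> = \<Psi> ?b + e *\<^sub>R \<Phi> c"
      using linear_map_on_pointwise(1)[OF lin(1) I cB[OF b(1)] eI]
        linear_map_on_pointwise(3)[OF lin(1) I c(1)] agree[OF b(1)] by simp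
    also have "\<Psi> ?b \<le> \<Psi> (\<lambda>x. ?h x + ?e x)"
      by (intro mono[OF pos(2)] hI subspace_pointwise[OF I] cB b eI le c)
    also have "\<dots> = \<Psi> ?h + e *\<^sub>R \<Psi> c"
      using linear_map_on_pointwise(1)[OF lin(2) I hI eI]
        linear_map_on_pointwise(3)[OF lin(2) I c(1)] by simp
    finally show ?thesis by (simp add: algebra_simps)
  qed
  have nonneg: "0 \<le> \<Phi> c" "0 \<le> \<Psi> c"
    using pos c by (auto simp: positive_linear_map_on_def le_fun_def)
  \<comment> \<open>The Archimedean property is available for \<open>\<Phi> c\<close> and \<open>\<Psi> c\<close> separately, so the two error
    terms are given independent indices and removed one after the other.\<close>
  have two: "\<Phi> ?h \<le> (\<Psi> ?h + inverse (real (Suc m)) *\<^sub>R \<Phi> c) + inverse (real (Suc n)) *\<^sub>R \<Psi> c" for m n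
  proof -
    let ?N = "inverse (real (Suc (max m n)))"
    have "?N \<le> inverse (real (Suc m))" "?N \<le> inverse (real (Suc n))" by auto
    then have "?N *\<^sub>R \<Phi> c \<le> inverse (real (Suc m)) *\<^sub>R \<Phi> c" "?N *\<^sub>R \<Psi> c \<le> inverse (real (Suc n)) *\<^sub>R \<Psi> c"
      using nonneg by (auto intro!: scaleR_right_mono)
    then have "\<Psi> ?h + ?N *\<^sub>R \<Phi> c + ?N *\<^sub>R \<Psi> c
        \<le> \<Psi> ?h + inverse (real (Suc m)) *\<^sub>R \<Phi> c + inverse (real (Suc n)) *\<^sub>R \<Psi> c"
      by (intro add_mono order_refl)
    moreover have "\<Phi> ?h \<le> \<Psi> ?h + ?N *\<^sub>R \<Phi> c + ?N *\<^sub>R \<Psi> c"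
      by (rule bound) simp
    ultimately show ?thesis by (rule order_trans[rotated])
  qed
  have "\<Phi> ?h \<le> \<Psi> ?h + inverse (real (Suc m)) *\<^sub>R \<Phi> c" for m
    by (rule archimedean_on_range[OF I lin(2) cont(2) c two])
  then show ?thesis
    by (rule archimedean_on_range[OF I lin(1) cont(1) c])
qed

text \<open>Squares of suitably scaled functions exceed \<open>1\<close> near any given point; by compactness finitely
  many of them suffice.\<close>

lemma subalgebra_dominates_on_compact:
  fixes B :: "('a::topological_space \<Rightarrow> real) set"
  assumes alg: "subalgebra_of Cfun B" and nv: "nowhere_vanishing B" and K: "compact K"
  obtains c where "c \<in> B" "\<And>x. 0 \<le> c x" "\<forall>x\<in>K. 1 \<le> c x"
proof -
  note B = subalgebra_ofD(1)[OF alg] and mult = subalgebra_ofD(3)[OF alg]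
  have Bc: "continuous_on UNIV b" if "b \<in> B" for b
    using that subalgebra_ofD(2)[OF alg] by (auto simp: Cfun_def)
  have op: "open {x. 1 < b x * b x}" if "b \<in> B" for b
    by (intro open_Collect_less continuous_intros Bc that)
  have "\<exists>b\<in>B. 1 < b x * b x" for x
  proof -
    obtain b where b: "b \<in> B" "b x \<noteq> 0" using nv by (auto simp: nowhere_vanishing_def)
    then show ?thesis by (intro bexI[OF _ subspace_pointwise(4)[OF B b(1), of "2 / b x"]]) auto
  qed
  then have cov: "K \<subseteq> (\<Union>b\<in>B. {x. 1 < b x * b x})" by blast
  obtain F where F: "F \<subseteq> B" "finite F" "K \<subseteq> (\<Union>b\<in>F. {x. 1 < b x * b x})"
    using compactE_image[OF K op cov] by blast
  let ?c = "\<lambda>x. \<Sum>b\<in>F. b x * b x"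
  show thesis
  proof
    show "?c \<in> B"
      using F(2,1) by (induction F) (auto intro!: subspace_pointwise[OF B] mult)
    show "0 \<le> ?c x" for x by (intro sum_nonneg) auto
    show "\<forall>x\<in>K. 1 \<le> ?c x"
    proof
      fix x assume "x \<in> K"
      obtain b where b: "b \<in> F" "1 < b x * b x" using F(3) \<open>x \<in> K\<close> by auto
      have "b x * b x \<le> ?c x"
        using F(2) b(1) by (intro member_le_sum[of b F "\<lambda>b. b x * b x"]) auto
      then show "1 \<le> ?c x" using b(2) by linarith
    qed
  qed
qed

text \<open>For \<open>f\<close> of compact support \<open>K\<close>, take \<open>c \<in> B\<close> with \<open>c \<ge> 1\<close> on \<open>K\<close> and apply the case of a
  Riesz subspace to the maps localised at \<open>c\<close>, the ideal \<open>C\<^sub>b(X)\<close> and the uniform closure of \<open>B\<close>.\<close>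

lemma agree_if_agree_on_subalgebra:
  fixes I :: "('a::t2_space \<Rightarrow> real) set"
    and \<Phi> \<Psi> :: "('a \<Rightarrow> real) \<Rightarrow> 'v::ordered_real_vector"
  assumes "Lindelof_space (euclidean :: 'a topology)"
    and "locally_compact_space (euclidean :: 'a topology)"
    and ideal: "riesz_ideal I"
    and pos: "positive_linear_map_on I \<Phi>" "positive_linear_map_on I \<Psi>"
    and cont: "strictly_continuous_on I \<Phi>" "strictly_continuous_on I \<Psi>"
    and alg: "subalgebra_of bcontfun B" and BI: "B \<subseteq> I"
    and sep: "strictly_point_separating B" and nv: "nowhere_vanishing B"
    and agree: "\<And>b. b \<in> B \<Longrightarrow> \<Phi> b = \<Psi> b"
    and "f \<in> I"
  shows "\<Phi> f = \<Psi> f"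
proof -
  have lin: "linear_map_on I \<Phi>" "linear_map_on I \<Psi>"
    using pos by (auto simp: positive_linear_map_on_def)
  show ?thesis
  proof (rule agree_if_agree_on_compact_support
      [OF assms(1-3) lin(1) cont(1) lin(2) cont(2) _ \<open>f \<in> I\<close>])
    fix f K
    assume f: "f \<in> I" "\<And>x. 0 \<le> f x" "compact K" "\<And>x. x \<notin> K \<Longrightarrow> f x = 0"
    have fc: "continuous_on UNIV f" using f(1) ideal by (auto simp: riesz_ideal_def Cfun_def)
    note Bb = subalgebra_ofD(2)[OF alg]
    have algC: "subalgebra_of Cfun B"
      using alg by (auto simp: subalgebra_of_def Cfun_def bcontfun_def)
    obtain c where c: "c \<in> B" "\<And>x. 0 \<le> c x" "\<forall>x\<in>K. 1 \<le> c x"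
      by (rule subalgebra_dominates_on_compact[OF algC nv f(3)])
        (assumption | rule that)+
    have cI: "c \<in> I" using c(1) BI by blast
    let ?\<Phi> = "\<lambda>h. \<Phi> (\<lambda>x. c x * h x)" and ?\<Psi> = "\<lambda>h. \<Psi> (\<lambda>x. c x * h x)"
    let ?R = "uniform_closure B"
    have R: "strictly_point_separating ?R" "nowhere_vanishing ?R"
      using strictly_point_separating_mono[OF subset_uniform_closure[OF Bb] sep]
        nowhere_vanishing_mono[OF subset_uniform_closure[OF Bb] nv] .
    have cB: "(\<lambda>x. c x * b x) \<in> B" if "b \<in> B" for b
      by (rule subalgebra_ofD(3)[OF alg c(1) that])
    have agR: "?\<Phi> r = ?\<Psi> r" if r: "r \<in> ?R" for r
    proof (rule antisym)
      show "?\<Phi> r \<le> ?\<Psi> r"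
        by (rule le_at_uniform_limit_multiplied[OF ideal pos cont cI c(2) r])
          (use cB BI agree in auto)
      show "?\<Psi> r \<le> ?\<Phi> r"
        by (rule le_at_uniform_limit_multiplied[OF ideal pos(2,1) cont(2,1) cI c(2) r])
          (use cB BI agree in auto)
    qed
    have cc: "continuous_on UNIV c" using c(1) Bb by (auto simp: bcontfun_def)
    \<comment> \<open>The maximum keeps the denominator away from \<open>0\<close>, so that \<open>g\<close> is continuous everywhere, and
      it does not affect \<open>c \<cdot> g = f\<close>: on \<open>K\<close> it equals \<open>c\<close>, and off \<open>K\<close> the numerator vanishes.\<close>
    define g where "g = (\<lambda>x. f x / max (c x) 1)"
    have "bounded (f ` K)"
      using compact_continuous_image[OF continuous_on_subset[OF fc] f(3)] compact_imp_bounded by blast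
    then obtain M where M: "\<And>x. x \<in> K \<Longrightarrow> \<bar>f x\<bar> \<le> M" by (auto simp: bounded_iff)
    have "g \<in> bcontfun"
    proof (rule bcontfun_normI)
      show "continuous_on UNIV g"
        unfolding g_def by (intro continuous_intros fc cc) auto
      show "norm (g x) \<le> max M 0" for x
      proof (cases "x \<in> K")
        case True
        have "\<bar>f x\<bar> / max (c x) 1 \<le> \<bar>f x\<bar> / 1" by (intro divide_left_mono) auto
        then show ?thesis using M[OF True] by (simp add: g_def abs_divide)
      qed (simp add: g_def f(4))
    qed
    note mult\<Phi> = multiplied_map_strictly_continuous[OF ideal lin(1) cont(1) cI c(2)]
      and mult\<Psi> = multiplied_map_strictly_continuous[OF ideal lin(2) cont(2) cI c(2)]
    have "?\<Phi> g = ?\<Psi> g"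
      by (rule agree_if_agree_on_riesz_subspace[OF assms(1,2) riesz_ideal_bcontfun mult\<Phi> mult\<Psi>
            riesz_subspace_uniform_closure[OF alg] R agR \<open>g \<in> bcontfun\<close>])
    moreover have "(\<lambda>x. c x * g x) = f"
    proof
      fix x show "c x * g x = f x"
        using c(3) f(4)[of x] by (cases "x \<in> K") (auto simp: g_def max_def)
    qed
    ultimately show "\<Phi> f = \<Psi> f" by simp
  qed
qed

section \<open>Uniqueness\<close>

theorem proposition4p6:
  fixes I :: "('a::t2_space \<Rightarrow> real) set"
    and \<Phi> \<Psi> :: "('a \<Rightarrow> real) \<Rightarrow> 'v::ordered_real_vector"
  assumes "Lindelof_space (euclidean :: 'a topology)"
    and "locally_compact_space (euclidean :: 'a topology)"
    and "riesz_ideal I"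
    and "positive_linear_map_on I \<Phi>" and "strictly_continuous_on I \<Phi>"
    and "positive_linear_map_on I \<Psi>" and "strictly_continuous_on I \<Psi>"
    and "(\<exists>R. riesz_subspace_of I R \<and> strictly_point_separating R \<and> nowhere_vanishing R \<and>
              (\<forall>r\<in>R. \<Phi> r = \<Psi> r)) \<or>
         (\<exists>B. subspace B \<and> B \<subseteq> I \<inter> bcontfun \<and> subalgebra_of bcontfun B \<and>
              strictly_point_separating B \<and> nowhere_vanishing B \<and>
              (\<forall>b\<in>B. \<Phi> b = \<Psi> b))"
  shows "\<forall>f\<in>I. \<Phi> f = \<Psi> f"
  using assms(8)
proof (elim disjE exE conjE)
  fix R
  assume "riesz_subspace_of I R" "strictly_point_separating R" "nowhere_vanishing R"
    "\<forall>r\<in>R. \<Phi> r = \<Psi> r"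
  moreover have "linear_map_on I \<Phi>" "linear_map_on I \<Psi>"
    using assms(4,6) by (auto simp: positive_linear_map_on_def)
  ultimately show ?thesis
    using agree_if_agree_on_riesz_subspace[OF assms(1-3)] assms(5,7) by blast
next
  fix B
  assume B: "subspace B" "B \<subseteq> I \<inter> bcontfun" "subalgebra_of bcontfun B"
    "strictly_point_separating B" "nowhere_vanishing B" "\<forall>b\<in>B. \<Phi> b = \<Psi> b"
  show ?thesis
  proof
    fix f assume "f \<in> I"
    show "\<Phi> f = \<Psi> f"
      by (rule agree_if_agree_on_subalgebra[OF assms(1-4,6,5,7) B(3) _ B(4,5) _ \<open>f \<in> I\<close>])
        (use B in auto)
  qed
qed

end
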